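(* Let $\mathbf G$ be a coherent canonical system, $\mathcal S$ a set of sequents and $s$ a sequent. If $\mathcal{S}\vdash^{seq}_{\mathbf G}s$ then $\mathcal{S}\vDash^{seq}_{\mathbf G}s$.
   Context: Syntax. $\mathcal{L}$ is a propositional language with atoms $p_1,p_2,\ldots$ and set of formulas $\mathcal{F}$. A sequent is $\Gamma\Rightarrow E$ with $\Gamma$ a finite set of formulas and $E$ a set of formulas with at most one element. A clause is a sequent of atoms. An $\mathcal{L}$-substitution is a map $\sigma:\mathcal{F}\to\mathcal{F}$ commuting with all connectives, extended pointwise to sets ($\sigma(\emptyset)=\emptyset$). A canonical right-introduction rule for an $n$-ary connective $\diamond$ is $\{\Pi_i\Rightarrow E_i\}_{1\le i\le m}/\ \Rightarrow\diamond(p_1,\dots,p_n)$ with $m\ge0$ and $\Pi_i\cup E_i\subseteq\{p_1,\dots,p_n\}$; an application infers $\Gamma\Rightarrow\sigma(\diamond(p_1,\dots,p_n))$ from $\Gamma,\sigma(\Pi_i)\Rightarrow\sigma(E_i)$ ($1\le i\le m$), for any finite $\Gamma$ and substitution $\sigma$. A canonical left-introduction rule is $\langle\{\Pi_i\Rightarrow E_i\}_{1\le i\le m},\{\Sigma_j\Rightarrow\}_{1\le j\le k}\rangle/\ \diamond(p_1,\dots,p_n)\Rightarrow$ with all atoms among $p_1,\dots,p_n$ (hard premises $\Pi_i\Rightarrow E_i$, soft premises $\Sigma_j\Rightarrow$); an application infers $\Gamma,\sigma(\diamond(p_1,\dots,p_n))\Rightarrow E$ from $\Gamma,\sigma(\Pi_i)\Rightarrow\sigma(E_i)$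 and $\Gamma,\sigma(\Sigma_j)\Rightarrow E$, for any sequent $\Gamma\Rightarrow E$ and substitution $\sigma$. A canonical system has axioms $\varphi\Rightarrow\varphi$, weakening (from $\Gamma\Rightarrow E$ infer $\Gamma,\Delta\Rightarrow E$; from $\Gamma\Rightarrow$ infer $\Gamma\Rightarrow\psi$), cut (from $\Gamma\Rightarrow\varphi$ and $\Delta,\varphi\Rightarrow E$ infer $\Gamma,\Delta\Rightarrow E$), and a set of canonical right- and left-introduction rules. $\mathcal{S}\vdash^{seq}_{\mathbf G}s$ means $s$ is derivable in $\mathbf G$ from the sequents of $\mathcal S$ as extra axioms. Coherence. A classical assignment $u$ satisfies a clause $\Pi\Rightarrow E$ iff $u(p)=f$ for some $p\in\Pi$ or $E=\{q\}$ with $u(q)=t$; $\mathbf G$ is coherent iff for every connective $\diamond$, whenever $\mathbf G$ contains a left rule $\langle S_1,S_2\rangle/\diamond(p_1,\dots,p_n)\Rightarrow$ and a right rule $S_3/\Rightarrow\diamond(p_1,\dots,p_n)$, no assignment satisfies all clauses of $S_1\cup S_2\cup S_3$. Semantics. For $\mathcal{U}$ closed under subformulas, a $\mathcal{U}$-semiframe is $\langle W,\le,v\rangle$ with $(W,\le)$ a nonempty partial order and $v:W\times\mathcal{U}\to\{t,f\}$ persistent ($v(a,\varphi)=t$, $a\le b$ imply $v(b,\varphi)=t$); an $\mathcal{L}$-frame is an $\mathcal{F}$-semiframe. $\Gamma\Rightarrow E$ is locally true at $a$ iff $\Gamma\cup E\subseteq\mathcal{U}$ and either $v(a,\psi)=f$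 for some $\psi\in\Gamma$ or $E=\{\varphi\}$ with $v(a,\varphi)=t$; true at $a$ iff locally true at all $b\ge a$. A semiframe is a model of a sequent iff it is true at every $a$, of a set of sequents iff of each. $\sigma$ (locally) satisfies a clause $\Gamma\Rightarrow E$ at $a$ iff $\sigma(\Gamma)\Rightarrow\sigma(E)$ is (locally) true at $a$. $\sigma$ fulfils a right rule at $a$ iff it satisfies all premises at $a$; a left rule iff it satisfies every hard premise at $a$ and locally satisfies every soft premise at $a$. A semiframe respects a rule $r$ for $\diamond$ iff for all $a$ and $\sigma$: if $\sigma$ fulfils $r$ at $a$ and $\sigma(\diamond(p_1,\dots,p_n))\in\mathcal U$ then $\sigma$ locally satisfies the conclusion of $r$ at $a$. It is $\mathbf G$-legal iff it respects all canonical rules of $\mathbf G$. $\mathcal{S}\vDash^{seq}_{\mathbf G}s$ iff every $\mathbf G$-legal $\mathcal{L}$-frame that is a model of $\mathcal S$ is a model of $s$. *)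

theory Defs
  imports Main
begin

section \<open>Syntax\<close>

text \<open>
  A propositional language is given by its signature: \<open>L c = Some n\<close> means that \<open>c\<close> is an
  \<open>n\<close>-ary connective of the language, \<open>L c = None\<close> that it is not a connective of it.
  The atom written \<open>p\<^sub>i\<close> (\<open>i \<ge> 1\<close>) on paper is \<open>Atom (i - 1)\<close>.
\<close>

type_synonym 'c signature = "'c \<Rightarrow> nat option"

datatype 'c form = Atom nat | Conn 'c "'c form list"

inductive_set formulas :: "'c signature \<Rightarrow> 'c form set" for L :: "'c signature" where
  atom: "Atom i \<in> formulas L"
| conn: "L c = Some (length \<phi>s) \<Longrightarrow> (\<And>\<phi>. \<phi> \<in> set \<phi>s \<Longrightarrow> \<phi> \<in> formulas L)
    \<Longrightarrow> Conn c \<phi>s \<in> formulas L"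

datatype 'c sequent = Sequent (ante: "'c form set") (succ: "'c form set") (infix "\<Rrightarrow>" 50)

definition sequent :: "'c signature \<Rightarrow> 'c sequent \<Rightarrow> bool" where
  "sequent L s \<longleftrightarrow> finite (ante s) \<and> ante s \<subseteq> formulas L
     \<and> finite (succ s) \<and> card (succ s) \<le> 1 \<and> succ s \<subseteq> formulas L"

definition clause :: "'c signature \<Rightarrow> 'c sequent \<Rightarrow> bool" where
  "clause L s \<longleftrightarrow> sequent L s \<and> ante s \<union> succ s \<subseteq> range Atom"

text \<open>The values of \<open>\<sigma>\<close> outside \<open>formulas L\<close> are irrelevant.\<close>

definition substitution :: "'c signature \<Rightarrow> ('c form \<Rightarrow> 'c form) \<Rightarrow> bool" where
  "substitution L \<sigma> \<longleftrightarrow> \<sigma> ` formulas L \<subseteq> formulas L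
     \<and> (\<forall>c \<phi>s. Conn c \<phi>s \<in> formulas L \<longrightarrow> \<sigma> (Conn c \<phi>s) = Conn c (map \<sigma> \<phi>s))"

definition subst_sequent :: "('c form \<Rightarrow> 'c form) \<Rightarrow> 'c sequent \<Rightarrow> 'c sequent" where
  "subst_sequent \<sigma> s = (\<sigma> ` ante s \<Rrightarrow> \<sigma> ` succ s)"

section \<open>Canonical systems\<close>

text \<open>
  \<open>RightRule c S\<close> is the rule \<open>S / \<Rightarrow> c(p\<^sub>1,\<dots>,p\<^sub>n)\<close>; \<open>LeftRule c S\<^sub>1 S\<^sub>2\<close> is the rule
  \<open>\<langle>S\<^sub>1, S\<^sub>2\<rangle> / c(p\<^sub>1,\<dots>,p\<^sub>n) \<Rightarrow>\<close> with hard premises \<open>S\<^sub>1\<close> and soft premises \<open>S\<^sub>2\<close>.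
\<close>

datatype 'c rule =
  RightRule 'c "'c sequent set"
| LeftRule 'c "'c sequent set" "'c sequent set"

definition rule_clauses :: "'c signature \<Rightarrow> nat \<Rightarrow> 'c sequent set \<Rightarrow> bool" where
  "rule_clauses L n S \<longleftrightarrow> finite S
     \<and> (\<forall>q\<in>S. clause L q \<and> ante q \<union> succ q \<subseteq> Atom ` {..<n})"

fun canonical_rule :: "'c signature \<Rightarrow> 'c rule \<Rightarrow> bool" where
  "canonical_rule L (RightRule c S) \<longleftrightarrow> (\<exists>n. L c = Some n \<and> rule_clauses L n S)"
| "canonical_rule L (LeftRule c S1 S2) \<longleftrightarrow> (\<exists>n. L c = Some n \<and> rule_clauses L n S1
     \<and> rule_clauses L n S2 \<and> (\<forall>q\<in>S2. succ q = {}))"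

text \<open>The formula \<open>c(p\<^sub>1,\<dots>,p\<^sub>n)\<close> for an \<open>n\<close>-ary connective \<open>c\<close>.\<close>

definition principal_form :: "'c signature \<Rightarrow> 'c \<Rightarrow> 'c form" where
  "principal_form L c = Conn c (map Atom [0..<the (L c)])"

text \<open>
  The structural part of a canonical system (identity axioms, weakening, cut) is fixed, so the
  system is identified with its set of canonical rules.
\<close>

definition canonical_system :: "'c signature \<Rightarrow> 'c rule set \<Rightarrow> bool" where
  "canonical_system L G \<longleftrightarrow> (\<forall>r\<in>G. canonical_rule L r)"

inductive derivable ::
  "'c signature \<Rightarrow> 'c rule set \<Rightarrow> 'c sequent set \<Rightarrow> 'c sequent \<Rightarrow> bool"
  for L :: "'c signature" and G :: "'c rule set" and S :: "'c sequent set" where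
  assumption: "s \<in> S \<Longrightarrow> derivable L G S s"
| identity: "\<phi> \<in> formulas L \<Longrightarrow> derivable L G S ({\<phi>} \<Rrightarrow> {\<phi>})"
| weaken_left: "derivable L G S (\<Gamma> \<Rrightarrow> E) \<Longrightarrow> finite \<Delta> \<Longrightarrow> \<Delta> \<subseteq> formulas L
    \<Longrightarrow> derivable L G S (\<Gamma> \<union> \<Delta> \<Rrightarrow> E)"
| weaken_right: "derivable L G S (\<Gamma> \<Rrightarrow> {}) \<Longrightarrow> \<psi> \<in> formulas L
    \<Longrightarrow> derivable L G S (\<Gamma> \<Rrightarrow> {\<psi>})"
| cut: "derivable L G S (\<Gamma> \<Rrightarrow> {\<phi>}) \<Longrightarrow> derivable L G S (\<Delta> \<union> {\<phi>} \<Rrightarrow> E)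
    \<Longrightarrow> derivable L G S (\<Gamma> \<union> \<Delta> \<Rrightarrow> E)"
| right: "RightRule c P \<in> G \<Longrightarrow> substitution L \<sigma> \<Longrightarrow> finite \<Gamma> \<Longrightarrow> \<Gamma> \<subseteq> formulas L
    \<Longrightarrow> (\<And>q. q \<in> P \<Longrightarrow> derivable L G S (\<Gamma> \<union> \<sigma> ` ante q \<Rrightarrow> \<sigma> ` succ q))
    \<Longrightarrow> derivable L G S (\<Gamma> \<Rrightarrow> {\<sigma> (principal_form L c)})"
| left: "LeftRule c P Q \<in> G \<Longrightarrow> substitution L \<sigma> \<Longrightarrow> sequent L (\<Gamma> \<Rrightarrow> E)
    \<Longrightarrow> (\<And>q. q \<in> P \<Longrightarrow> derivable L G S (\<Gamma> \<union> \<sigma> ` ante q \<Rrightarrow> \<sigma> ` succ q))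
    \<Longrightarrow> (\<And>q. q \<in> Q \<Longrightarrow> derivable L G S (\<Gamma> \<union> \<sigma> ` ante q \<Rrightarrow> E))
    \<Longrightarrow> derivable L G S (\<Gamma> \<union> {\<sigma> (principal_form L c)} \<Rrightarrow> E)"

definition assignment_satisfies :: "(nat \<Rightarrow> bool) \<Rightarrow> 'c sequent \<Rightarrow> bool" where
  "assignment_satisfies u q \<longleftrightarrow>
     (\<exists>i. Atom i \<in> ante q \<and> \<not> u i) \<or> (\<exists>i. succ q = {Atom i} \<and> u i)"

definition coherent :: "'c rule set \<Rightarrow> bool" where
  "coherent G \<longleftrightarrow> (\<forall>c S1 S2 S3. LeftRule c S1 S2 \<in> G \<and> RightRule c S3 \<in> G
     \<longrightarrow> \<not> (\<exists>u. \<forall>q \<in> S1 \<union> S2 \<union> S3. assignment_satisfies u q))"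

section \<open>Semantics\<close>

text \<open>
  The domain \<open>\<U>\<close> of the valuation is passed separately; \<open>val\<close> matters only on
  \<open>worlds \<times> \<U>\<close>.
\<close>

record ('w, 'c) semiframe =
  worlds :: "'w set"
  order :: "'w rel"
  val :: "'w \<Rightarrow> 'c form \<Rightarrow> bool"

definition is_semiframe ::
  "'c signature \<Rightarrow> 'c form set \<Rightarrow> ('w, 'c) semiframe \<Rightarrow> bool" where
  "is_semiframe L \<U> M \<longleftrightarrow>
     \<U> \<subseteq> formulas L \<and> (\<forall>c \<phi>s. Conn c \<phi>s \<in> \<U> \<longrightarrow> set \<phi>s \<subseteq> \<U>)
     \<and> worlds M \<noteq> {} \<and> partial_order_on (worlds M) (order M)
     \<and> (\<forall>a b. \<forall>\<phi>\<in>\<U>. val M a \<phi> \<and> (a, b) \<in> order M \<longrightarrow> val M b \<phi>)"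

abbreviation is_frame :: "'c signature \<Rightarrow> ('w, 'c) semiframe \<Rightarrow> bool" where
  "is_frame L M \<equiv> is_semiframe L (formulas L) M"

definition locally_true ::
  "'c form set \<Rightarrow> ('w, 'c) semiframe \<Rightarrow> 'w \<Rightarrow> 'c sequent \<Rightarrow> bool" where
  "locally_true \<U> M a s \<longleftrightarrow> ante s \<union> succ s \<subseteq> \<U>
     \<and> ((\<exists>\<psi>\<in>ante s. \<not> val M a \<psi>) \<or> (\<exists>\<phi>. succ s = {\<phi>} \<and> val M a \<phi>))"

definition true_at ::
  "'c form set \<Rightarrow> ('w, 'c) semiframe \<Rightarrow> 'w \<Rightarrow> 'c sequent \<Rightarrow> bool" where
  "true_at \<U> M a s \<longleftrightarrow> (\<forall>b. (a, b) \<in> order M \<longrightarrow> locally_true \<U> M b s)"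

definition model_of :: "'c form set \<Rightarrow> ('w, 'c) semiframe \<Rightarrow> 'c sequent \<Rightarrow> bool" where
  "model_of \<U> M s \<longleftrightarrow> (\<forall>a \<in> worlds M. true_at \<U> M a s)"

definition locally_satisfies ::
  "'c form set \<Rightarrow> ('w, 'c) semiframe \<Rightarrow> ('c form \<Rightarrow> 'c form) \<Rightarrow> 'w \<Rightarrow> 'c sequent \<Rightarrow> bool" where
  "locally_satisfies \<U> M \<sigma> a q \<longleftrightarrow> locally_true \<U> M a (subst_sequent \<sigma> q)"

definition satisfies ::
  "'c form set \<Rightarrow> ('w, 'c) semiframe \<Rightarrow> ('c form \<Rightarrow> 'c form) \<Rightarrow> 'w \<Rightarrow> 'c sequent \<Rightarrow> bool" where
  "satisfies \<U> M \<sigma> a q \<longleftrightarrow> true_at \<U> M a (subst_sequent \<sigma> q)"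

fun fulfils ::
  "'c form set \<Rightarrow> ('w, 'c) semiframe \<Rightarrow> ('c form \<Rightarrow> 'c form) \<Rightarrow> 'w \<Rightarrow> 'c rule \<Rightarrow> bool" where
  "fulfils \<U> M \<sigma> a (RightRule c P) \<longleftrightarrow> (\<forall>q\<in>P. satisfies \<U> M \<sigma> a q)"
| "fulfils \<U> M \<sigma> a (LeftRule c P Q) \<longleftrightarrow>
     (\<forall>q\<in>P. satisfies \<U> M \<sigma> a q) \<and> (\<forall>q\<in>Q. locally_satisfies \<U> M \<sigma> a q)"

fun rule_conn :: "'c rule \<Rightarrow> 'c" where
  "rule_conn (RightRule c P) = c"
| "rule_conn (LeftRule c P Q) = c"

fun conclusion :: "'c signature \<Rightarrow> 'c rule \<Rightarrow> 'c sequent" where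
  "conclusion L (RightRule c P) = ({} \<Rrightarrow> {principal_form L c})"
| "conclusion L (LeftRule c P Q) = ({principal_form L c} \<Rrightarrow> {})"

definition respects_rule ::
  "'c signature \<Rightarrow> 'c form set \<Rightarrow> ('w, 'c) semiframe \<Rightarrow> 'c rule \<Rightarrow> bool" where
  "respects_rule L \<U> M r \<longleftrightarrow> (\<forall>a \<in> worlds M. \<forall>\<sigma>. substitution L \<sigma>
     \<longrightarrow> fulfils \<U> M \<sigma> a r \<longrightarrow> \<sigma> (principal_form L (rule_conn r)) \<in> \<U>
     \<longrightarrow> locally_satisfies \<U> M \<sigma> a (conclusion L r))"

definition legal ::
  "'c signature \<Rightarrow> 'c rule set \<Rightarrow> 'c form set \<Rightarrow> ('w, 'c) semiframe \<Rightarrow> bool" where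
  "legal L G \<U> M \<longleftrightarrow> (\<forall>r\<in>G. respects_rule L \<U> M r)"

text \<open>
  HOL cannot quantify over all types inside a formula, so the type \<open>'w\<close> from which the worlds
  are drawn is a parameter; the frames range over all nonempty subsets of it.
\<close>

definition entails ::
  "'w itself \<Rightarrow> 'c signature \<Rightarrow> 'c rule set \<Rightarrow> 'c sequent set \<Rightarrow> 'c sequent \<Rightarrow> bool" where
  "entails (_ :: 'w itself) L G S s \<longleftrightarrow>
     (\<forall>M :: ('w, 'c) semiframe. is_frame L M \<and> legal L G (formulas L) M
        \<and> (\<forall>t\<in>S. model_of (formulas L) M t)
      \<longrightarrow> model_of (formulas L) M s)"

end

theory Submission
  imports Defs
begin

text \<open>
  By induction on the derivation, every derivable sequent is locally true at every world of a
  legal frame that is a model of the assumptions. For the introduction rules, if the context is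
  true at a world then by persistence it stays true above it, so the premises become true
  there without the context, the rule is fulfilled, and legality gives the conclusion.
\<close>

text \<open>Truth at a world gives local truth there by reflexivity; conversely, every point above a
  world is again a world. So the induction can work with local truth alone.\<close>

lemma model_of_iff_locally_true:
  assumes "is_semiframe L \<U> M"
  shows "model_of \<U> M s \<longleftrightarrow> (\<forall>a\<in>worlds M. locally_true \<U> M a s)"
proof -
  have "order M \<subseteq> worlds M \<times> worlds M" "refl_on (worlds M) (order M)"
    using assms by (auto simp: is_semiframe_def partial_order_on_def preorder_on_def)
  then show ?thesis
    unfolding model_of_def true_at_def by (auto dest: refl_onD)
qed

lemma order_worlds:
  assumes "is_semiframe L \<U> M" and "(a, b) \<in> order M"
  shows "b \<in> worlds M"
  using assms by (auto simp: is_semiframe_def partial_order_on_def preorder_on_def)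

lemma locally_true_drop_context:
  assumes "locally_true \<U> M a (\<Gamma> \<union> \<Pi> \<Rrightarrow> E)" and "\<forall>\<psi>\<in>\<Gamma>. val M a \<psi>"
  shows "locally_true \<U> M a (\<Pi> \<Rrightarrow> E)"
  using assms by (auto simp: locally_true_def)

text \<open>Handles premises of right rules and hard premises of left rules. Satisfaction at
  \<open>a\<close> concerns all worlds above \<open>a\<close>, so \<open>prem\<close> is needed at
  every world, whereas persistence lets truth of the context be asked at \<open>a\<close>
  only.\<close>

lemma satisfies_if_context_true:
  assumes M: "is_semiframe L \<U> M"
    and prem: "\<forall>b\<in>worlds M. locally_true \<U> M b (\<Gamma> \<union> \<sigma> ` ante q \<Rrightarrow> \<sigma> ` succ q)"
    and \<Gamma>: "\<Gamma> \<subseteq> \<U>" "\<forall>\<psi>\<in>\<Gamma>. val M a \<psi>"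
  shows "satisfies \<U> M \<sigma> a q"
  unfolding satisfies_def true_at_def subst_sequent_def
proof (intro allI impI)
  fix b assume b: "(a, b) \<in> order M"
  then have "\<forall>\<psi>\<in>\<Gamma>. val M b \<psi>"
    using M \<Gamma> unfolding is_semiframe_def by blast
  then show "locally_true \<U> M b (\<sigma> ` ante q \<Rrightarrow> \<sigma> ` succ q)"
    by (rule locally_true_drop_context[OF bspec[OF prem order_worlds[OF M b]]])
qed

lemma subst_principal_form_in_formulas:
  assumes "canonical_system L G" and "r \<in> G" and "substitution L \<sigma>"
  shows "\<sigma> (principal_form L (rule_conn r)) \<in> formulas L"
proof -
  \<comment> \<open>Canonicity of the rule rules out \<open>None\<close>, so the \<open>the\<close>
    in \<open>principal_form\<close> yields a genuine arity.\<close>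
  obtain n where "L (rule_conn r) = Some n"
    using assms(1,2) by (cases r) (fastforce simp: canonical_system_def)+
  then have "principal_form L (rule_conn r) \<in> formulas L"
    by (auto simp: principal_form_def intro!: formulas.intros)
  then show ?thesis
    using assms(3) by (auto simp: substitution_def)
qed

lemma derivable_locally_true:
  assumes G: "canonical_system L G" and M: "is_frame L M" and legal: "legal L G (formulas L) M"
    and S: "\<forall>t\<in>S. model_of (formulas L) M t"
    and "derivable L G S s"
  shows "\<forall>a\<in>worlds M. locally_true (formulas L) M a s"
  using \<open>derivable L G S s\<close>
proof induction
  case (assumption s)
  then show ?case using S model_of_iff_locally_true[OF M] by blast
next
  case (identity \<phi>)
  then show ?case by (auto simp: locally_true_def)
next
  case (weaken_left \<Gamma> E \<Delta>)
  then show ?case by (auto simp: locally_true_def)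
next
  case (weaken_right \<Gamma> \<psi>)
  then show ?case by (auto simp: locally_true_def)
next
  case (cut \<Gamma> \<phi> \<Delta> E)
  show ?case
  proof
    fix a assume "a \<in> worlds M"
    then have "locally_true (formulas L) M a (\<Gamma> \<Rrightarrow> {\<phi>})"
      and "locally_true (formulas L) M a (\<Delta> \<union> {\<phi>} \<Rrightarrow> E)"
      using cut.IH by blast+
    \<comment> \<open>Split on the value of \<open>\<phi>\<close> at \<open>a\<close>: if false, the
      first premise provides a false member of \<open>\<Gamma>\<close>; if true, the second is
      witnessed by \<open>\<Delta>\<close> or \<open>E\<close>.\<close>
    then show "locally_true (formulas L) M a (\<Gamma> \<union> \<Delta> \<Rrightarrow> E)"
      by (auto simp: locally_true_def)
  qed
next
  case (right c P \<sigma> \<Gamma>)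
  let ?A = "\<sigma> (principal_form L c)"
  have A: "?A \<in> formulas L"
    using subst_principal_form_in_formulas[OF G right.hyps(1,2)] by simp
  show ?case
  proof
    fix a assume a: "a \<in> worlds M"
    \<comment> \<open>A false member of \<open>\<Gamma>\<close> would make the conclusion locally
      true at once.\<close>
    have "val M a ?A" if \<Gamma>: "\<forall>\<psi>\<in>\<Gamma>. val M a \<psi>"
    proof -
      have "fulfils (formulas L) M \<sigma> a (RightRule c P)"
        using satisfies_if_context_true[OF M _ right.hyps(4) \<Gamma>] right.IH by auto
      then have "locally_satisfies (formulas L) M \<sigma> a (conclusion L (RightRule c P))"
        using legal right.hyps(1,2) a A unfolding legal_def respects_rule_def by fastforce
      then show ?thesis
        by (auto simp: locally_satisfies_def locally_true_def subst_sequent_def)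
    qed
    then show "locally_true (formulas L) M a (\<Gamma> \<Rrightarrow> {?A})"
      using A right.hyps(4) by (auto simp: locally_true_def)
  qed
next
  case (left c P Q \<sigma> \<Gamma> E)
  let ?A = "\<sigma> (principal_form L c)"
  have A: "?A \<in> formulas L"
    using subst_principal_form_in_formulas[OF G left.hyps(1,2)] by simp
  have \<Gamma>E: "\<Gamma> \<subseteq> formulas L" "E \<subseteq> formulas L"
    using left.hyps(3) by (auto simp: sequent_def)
  have soft: "succ q = {}" if "q \<in> Q" for q
    using G left.hyps(1) that by (fastforce simp: canonical_system_def)
  show ?case
  proof
    fix a assume a: "a \<in> worlds M"
    \<comment> \<open>\<open>E\<close> may be false at \<open>a\<close> and become true above it, so
      the soft premises, which carry \<open>E\<close>, can be freed of it only locally at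
      \<open>a\<close>. The hard premises do not carry \<open>E\<close> and hold at all worlds
      above.\<close>
    have "\<not> val M a ?A" if \<Gamma>: "\<forall>\<psi>\<in>\<Gamma>. val M a \<psi>" and E: "\<not> (\<exists>\<phi>. E = {\<phi>} \<and> val M a \<phi>)"
    proof -
      have "locally_satisfies (formulas L) M \<sigma> a q" if q: "q \<in> Q" for q
      proof -
        have "locally_true (formulas L) M a (\<Gamma> \<union> \<sigma> ` ante q \<Rrightarrow> E)"
          using left.IH(2)[OF q] a by blast
        \<comment> \<open>With \<open>E\<close> false at \<open>a\<close>, it can be replaced by the
          empty succedent of the soft premise.\<close>
        then show ?thesis
          using \<Gamma> E soft[OF q]
          by (auto simp: locally_satisfies_def locally_true_def subst_sequent_def)
      qed
      then have "fulfils (formulas L) M \<sigma> a (LeftRule c P Q)"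
        using satisfies_if_context_true[OF M _ \<Gamma>E(1) \<Gamma>] left.IH(1) by auto
      then have "locally_satisfies (formulas L) M \<sigma> a (conclusion L (LeftRule c P Q))"
        using legal left.hyps(1,2) a A unfolding legal_def respects_rule_def by fastforce
      then show ?thesis
        by (auto simp: locally_satisfies_def locally_true_def subst_sequent_def)
    qed
    then show "locally_true (formulas L) M a (\<Gamma> \<union> {?A} \<Rrightarrow> E)"
      using A \<Gamma>E by (auto simp: locally_true_def)
  qed
qed

theorem theorem6p1:
  fixes L :: "'c signature" and G :: "'c rule set"
    and S :: "'c sequent set" and s :: "'c sequent"
  assumes "canonical_system L G" and "coherent G"
    and "\<forall>t\<in>S. sequent L t" and "sequent L s"
    and "derivable L G S s"
  shows "entails TYPE('w) L G S s"
  unfolding entails_def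
  using derivable_locally_true[OF assms(1) _ _ _ assms(5)] model_of_iff_locally_true by blast

end
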